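(* Let $r\ge 1$, let $n_1,\dots,n_{2r}$ be positive integers, let $\mathcal{A}=(a_{i_1,\dots,i_{2r}})\in\mathbb{R}^{n_1\times\cdots\times n_{2r}}$ be a hypermatrix, and let $A$ be the $\big(\prod_{s=1}^r n_s\big)\times\big(\prod_{s=1}^{r} n_{r+s}\big)$ matrix obtained by arranging $\mathcal{A}$ with rows labeled by $(i_1,\dots,i_r)$ and columns labeled by $(i_{r+1},\dots,i_{2r})$, both in lexicographic order. Let $\sigma$ be the permutation of $\{1,\dots,2r\}$ given by $(\sigma(1),\sigma(2),\dots,\sigma(2r))=(1,r+1,2,r+2,\dots,r,2r)$. Then $\mathcal{A}$ is matrix form decomposable, i.e. there exist real $n_s\times n_{r+s}$ matrices $A_s$, $s=1,\dots,r$, with $$A=A_1\otimes A_2\otimes\cdots\otimes A_r,$$ if and only if the vector $W^{\sigma}_{[n_1,n_2,\dots,n_{2r}]}V_r(A)$ is decomposable with respect to $n_1n_{r+1},\,n_2n_{r+2},\,\dots,\,n_rn_{2r}$, i.e. there exist $x_s\in\mathbb{R}^{n_sn_{r+s}}$, $s=1,\dots,r$, such that $$W^{\sigma}_{[n_1,n_2,\dots,n_{2r}]}V_r(A)=x_1\otimes x_2\otimes\cdots\otimes x_r.$$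
   Context: A hypermatrix $\mathcal{A}=(a_{i_1,\dots,i_{2r}})\in\mathbb{R}^{n_1\times\cdots\times n_{2r}}$ is a real array indexed by $i_s\in\{1,\dots,n_s\}$. $\otimes$ is the Kronecker product (for column vectors it coincides with the semi-tensor product $\ltimes$ used in the paper). For a matrix $M$, $V_r(M)$ is its row stacking form: the column vector obtained by listing the entries of $M$ row by row. For positive integers $n_1,\dots,n_d$ with $n=\prod_{s=1}^d n_s$ and a permutation $\sigma$ of $\{1,\dots,d\}$, the permutation matrix $W^{\sigma}_{[n_1,\dots,n_d]}$ is the unique $n\times n$ real matrix such that $W^{\sigma}_{[n_1,\dots,n_d]}(x_1\otimes\cdots\otimes x_d)=x_{\sigma(1)}\otimes\cdots\otimes x_{\sigma(d)}$ for all $x_s\in\mathbb{R}^{n_s}$, $s=1,\dots,d$. *)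

theory Defs
  imports "Jordan_Normal_Form.Matrix" "HOL-Combinatorics.Permutations"
begin

text \<open>
  All indices are 0-based: an index \<open>i \<in> {1,\<dots>,n}\<close> is represented by \<open>i - 1 \<in> {0..<n}\<close>, and
  permutations of \<open>{1,\<dots>,d}\<close> by permutations of \<open>{..<d}\<close>.  A sequence of dimensions is a list
  \<open>ns\<close>, and a hypermatrix of these dimensions is a function on multi-indices; only its values on
  the multi-indices in \<open>set (lex_indices ns)\<close> matter.
\<close>

type_synonym hypermatrix = "nat list \<Rightarrow> real"

text \<open>\<^const>\<open>product_lists\<close> enumerates in lexicographic order (last index running fastest).\<close>

definition lex_indices :: "nat list \<Rightarrow> nat list list" where
  "lex_indices ns = product_lists (map (\<lambda>n. [0..<n]) ns)"

definition matrix_form :: "nat \<Rightarrow> nat list \<Rightarrow> hypermatrix \<Rightarrow> real mat" where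
  "matrix_form r ns a =
     mat (prod_list (take r ns)) (prod_list (drop r ns))
       (\<lambda>(p, q). a (lex_indices (take r ns) ! p @ lex_indices (drop r ns) ! q))"

definition kron_mat :: "real mat \<Rightarrow> real mat \<Rightarrow> real mat" where
  "kron_mat A B =
     mat (dim_row A * dim_row B) (dim_col A * dim_col B)
       (\<lambda>(i, j). A $$ (i div dim_row B, j div dim_col B) * B $$ (i mod dim_row B, j mod dim_col B))"

definition kron_vec :: "real vec \<Rightarrow> real vec \<Rightarrow> real vec" where
  "kron_vec x y =
     vec (dim_vec x * dim_vec y) (\<lambda>i. x $ (i div dim_vec y) * y $ (i mod dim_vec y))"

text \<open>\<^const>\<open>kron_vec\<close> is the Kronecker product of column vectors, seen as matrices with one column.\<close>

lemma kron_vec_conv_kron_mat: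
  "mat_of_cols (dim_vec x * dim_vec y) [kron_vec x y] =
     kron_mat (mat_of_cols (dim_vec x) [x]) (mat_of_cols (dim_vec y) [y])"
proof (rule eq_matI)
  fix i j
  assume "i < dim_row (kron_mat (mat_of_cols (dim_vec x) [x]) (mat_of_cols (dim_vec y) [y]))"
    and "j < dim_col (kron_mat (mat_of_cols (dim_vec x) [x]) (mat_of_cols (dim_vec y) [y]))"
  then have i: "i < dim_vec x * dim_vec y" and j: "j = 0"
    by (simp_all add: kron_mat_def)
  from i have "dim_vec y > 0" by (cases "dim_vec y") auto
  with i show "mat_of_cols (dim_vec x * dim_vec y) [kron_vec x y] $$ (i, j) =
      kron_mat (mat_of_cols (dim_vec x) [x]) (mat_of_cols (dim_vec y) [y]) $$ (i, j)"
    by (simp add: j kron_mat_def kron_vec_def mat_of_cols_def less_mult_imp_div_less)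
qed (simp_all add: kron_mat_def)

text \<open>The units \<open>1\<^sub>m 1\<close> and \<open>vec 1 (\<lambda>_. 1)\<close> only serve to end the recursion.\<close>

definition kron_mats :: "real mat list \<Rightarrow> real mat" where
  "kron_mats As = foldr kron_mat As (1\<^sub>m 1)"

definition kron_vecs :: "real vec list \<Rightarrow> real vec" where
  "kron_vecs xs = foldr kron_vec xs (vec 1 (\<lambda>_. 1))"

definition row_stacking :: "real mat \<Rightarrow> real vec" where
  "row_stacking M =
     vec (dim_row M * dim_col M) (\<lambda>k. M $$ (k div dim_col M, k mod dim_col M))"

definition is_swap_matrix :: "nat list \<Rightarrow> (nat \<Rightarrow> nat) \<Rightarrow> real mat \<Rightarrow> bool" where
  "is_swap_matrix ns \<sigma> W \<longleftrightarrow>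
     W \<in> carrier_mat (prod_list ns) (prod_list ns) \<and>
     (\<forall>xs. length xs = length ns \<longrightarrow> (\<forall>s<length ns. xs ! s \<in> carrier_vec (ns ! s)) \<longrightarrow>
        W *\<^sub>v kron_vecs xs = kron_vecs (map (\<lambda>s. xs ! \<sigma> s) [0..<length ns]))"

text \<open>Existence and uniqueness are shown in \<open>ex1_swap_matrix\<close> below.\<close>

definition swap_matrix :: "nat list \<Rightarrow> (nat \<Rightarrow> nat) \<Rightarrow> real mat" where
  "swap_matrix ns \<sigma> = (THE W. is_swap_matrix ns \<sigma> W)"

definition matrix_form_decomposable :: "nat \<Rightarrow> nat list \<Rightarrow> hypermatrix \<Rightarrow> bool" where
  "matrix_form_decomposable r ns a \<longleftrightarrow>
     (\<exists>As. length As = r \<and> (\<forall>s<r. As ! s \<in> carrier_mat (ns ! s) (ns ! (r + s))) \<and>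
        matrix_form r ns a = kron_mats As)"

definition decomposable_vec :: "nat list \<Rightarrow> real vec \<Rightarrow> bool" where
  "decomposable_vec ms v \<longleftrightarrow>
     (\<exists>xs. length xs = length ms \<and> (\<forall>s<length ms. xs ! s \<in> carrier_vec (ms ! s)) \<and>
        v = kron_vecs xs)"


subsection \<open>Well-definedness of the swap matrix\<close>

lemma length_lex_indices: "length (lex_indices ns) = prod_list ns"
  by (induction ns) (auto simp: lex_indices_def length_concat comp_def sum_list_triv)

lemma set_lex_indices:
  "set (lex_indices ns) = {is. length is = length ns \<and> (\<forall>s<length ns. is ! s < ns ! s)}"
  by (auto simp: lex_indices_def product_lists_set list_all2_conv_all_nth)

lemma distinct_lex_indices: "distinct (lex_indices ns)"
  unfolding lex_indices_def by (rule distinct_product_lists) auto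

lemma nth_concat_uniform:
  assumes "\<And>x. x \<in> set xs \<Longrightarrow> length (f x) = m" "k < length xs * m"
  shows "concat (map f xs) ! k = f (xs ! (k div m)) ! (k mod m)"
  using assms
proof (induction xs arbitrary: k)
  case (Cons x xs)
  then have "m > 0" by (cases m) auto
  with Cons show ?case
    by (cases "k < m") (auto simp: nth_append le_div_geq le_mod_geq)
qed simp

lemma nth_lex_indices_Cons:
  assumes "k < n * prod_list ns"
  shows "lex_indices (n # ns) ! k =
           (k div prod_list ns) # lex_indices ns ! (k mod prod_list ns)"
proof -
  have m: "prod_list ns > 0" using assms by (cases "prod_list ns") auto
  then have "k div prod_list ns < n" using assms by (simp add: less_mult_imp_div_less)
  moreover have "lex_indices (n # ns) = concat (map (\<lambda>x. map (Cons x) (lex_indices ns)) [0..<n])"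
    by (simp add: lex_indices_def)
  ultimately show ?thesis
    using assms m by (simp add: nth_concat_uniform[where m = "prod_list ns"] length_lex_indices)
qed

lemma dim_kron_vecs: "dim_vec (kron_vecs xs) = prod_list (map dim_vec xs)"
  by (induction xs) (auto simp: kron_vecs_def kron_vec_def)

lemma kron_vecs_index:
  assumes "k < prod_list (map dim_vec xs)"
  shows "kron_vecs xs $ k = (\<Prod>s<length xs. xs ! s $ (lex_indices (map dim_vec xs) ! k ! s))"
  using assms
proof (induction xs arbitrary: k)
  case Nil
  then show ?case by (simp add: kron_vecs_def)
next
  case (Cons x xs)
  let ?m = "prod_list (map dim_vec xs)"
  have "?m > 0" using Cons.prems by (cases ?m) auto
  then have "k mod ?m < ?m" by simp
  moreover have "kron_vecs (x # xs) $ k = x $ (k div ?m) * kron_vecs xs $ (k mod ?m)"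
    using Cons.prems dim_kron_vecs[of xs] by (simp add: kron_vecs_def kron_vec_def)
  ultimately show ?case
    using Cons by (simp add: nth_lex_indices_Cons prod.lessThan_Suc_shift del: prod.lessThan_Suc)
qed

lemma ex1_swap_matrix:
  assumes \<sigma>: "\<sigma> permutes {..<length ns}"
  shows "\<exists>!W. is_swap_matrix ns \<sigma> W"
proof -
  let ?d = "length ns" and ?n = "prod_list ns"
  define L where "L = lex_indices ns"
  define ns' where "ns' = map (\<lambda>s. ns ! \<sigma> s) [0..<?d]"
  define L' where "L' = lex_indices ns'"
  have \<sigma>_less: "\<sigma> s < ?d" if "s < ?d" for s
    using permutes_in_image[OF \<sigma>, of s] that by simp
  have "?n = (\<Prod>s<?d. ns ! s)"
    by (simp add: prod.list_conv_set_nth atLeast0LessThan)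
  also have "\<dots> = (\<Prod>s<?d. ns ! \<sigma> s)"
    by (rule prod.permute[OF \<sigma>, unfolded comp_def])
  also have "\<dots> = prod_list ns'"
    by (simp add: ns'_def prod.list_conv_set_nth atLeast0LessThan)
  finally have n': "prod_list ns' = ?n" by simp
  have lenL: "length L = ?n" and lenL': "length L' = ?n"
    by (simp_all add: L_def L'_def length_lex_indices n')
  have Lnth: "length (L ! j) = ?d" "s < ?d \<Longrightarrow> L ! j ! s < ns ! s" if "j < ?n" for j s
    using nth_mem[of j L] that by (simp_all add: L_def length_lex_indices set_lex_indices)
  have L'nth: "length (L' ! j) = ?d" "s < ?d \<Longrightarrow> L' ! j ! s < ns ! \<sigma> s" if "j < ?n" for j s
    using nth_mem[of j L'] that n'
    by (simp_all add: L'_def length_lex_indices set_lex_indices) (simp_all add: ns'_def)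
  have Leq: "j = k" if "j < ?n" "k < ?n" "\<And>s. s < ?d \<Longrightarrow> L ! j ! s = L ! k ! s" for j k
  proof -
    have "L ! j = L ! k" using that Lnth by (intro nth_equalityI) auto
    then show ?thesis
      using that lenL by (simp add: nth_eq_iff_index_eq L_def distinct_lex_indices)
  qed
  have kron: "kron_vecs xs $ k = (\<Prod>s<?d. xs ! s $ (L ! k ! s))"
    and dimk: "dim_vec (kron_vecs xs) = ?n"
    if "length xs = ?d" "\<forall>s<?d. xs ! s \<in> carrier_vec (ns ! s)" "k < ?n" for xs k
  proof -
    have "map dim_vec xs = ns" using that by (intro nth_equalityI) auto
    then show "kron_vecs xs $ k = (\<Prod>s<?d. xs ! s $ (L ! k ! s))" "dim_vec (kron_vecs xs) = ?n"
      using that kron_vecs_index[of k xs] by (auto simp: L_def dim_kron_vecs)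
  qed
  have ex: "\<exists>j<?n. \<forall>s<?d. L ! j ! \<sigma> s = L' ! i ! s" if i: "i < ?n" for i
  proof -
    define js where "js = map (\<lambda>s. L' ! i ! (inv_into UNIV \<sigma> s)) [0..<?d]"
    have inv: "inv_into UNIV \<sigma> s < ?d" "\<sigma> (inv_into UNIV \<sigma> s) = s" if "s < ?d" for s
      using permutes_in_image[OF permutes_inv[OF \<sigma>], of s] that permutes_inverses(1)[OF \<sigma>]
      by auto
    have "L' ! i ! inv_into UNIV \<sigma> s < ns ! s" if "s < ?d" for s
      using L'nth(2)[OF i inv(1)[OF that]] inv(2)[OF that] by simp
    then have "js \<in> set L"
      by (simp add: L_def set_lex_indices js_def)
    then obtain j where "j < ?n" "L ! j = js"
      by (auto simp: in_set_conv_nth lenL)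
    then show ?thesis
      using \<sigma>_less permutes_inverses(2)[OF \<sigma>] by (intro exI[of _ j]) (auto simp: js_def)
  qed
  then obtain f where f: "\<And>i. i < ?n \<Longrightarrow> f i < ?n"
      "\<And>i s. i < ?n \<Longrightarrow> s < ?d \<Longrightarrow> L ! f i ! \<sigma> s = L' ! i ! s"
    by metis
  define W :: "real mat" where "W = mat ?n ?n (\<lambda>(i, j). if j = f i then 1 else 0)"
  have "is_swap_matrix ns \<sigma> W"
    unfolding is_swap_matrix_def
  proof (intro conjI allI impI)
    fix xs :: "real vec list"
    assume len: "length xs = ?d" and xs: "\<forall>s<?d. xs ! s \<in> carrier_vec (ns ! s)"
    let ?ys = "map (\<lambda>s. xs ! \<sigma> s) [0..<?d]"
    have ys: "map dim_vec ?ys = ns'"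
      using xs \<sigma>_less by (auto simp: ns'_def)
    have dimy: "dim_vec (kron_vecs ?ys) = ?n"
      by (simp only: dim_kron_vecs ys n')
    show "W *\<^sub>v kron_vecs xs = kron_vecs ?ys"
    proof (rule eq_vecI)
      fix i assume "i < dim_vec (kron_vecs ?ys)"
      then have i: "i < ?n" using dimy by simp
      have "(W *\<^sub>v kron_vecs xs) $ i = (\<Sum>j<?n. (if j = f i then 1 else 0) * kron_vecs xs $ j)"
        using i dimk[OF len xs i]
        by (simp add: W_def scalar_prod_def row_def atLeast0LessThan)
      also have "\<dots> = (\<Sum>j<?n. if j = f i then kron_vecs xs $ j else 0)"
        by (rule sum.cong) auto
      also have "\<dots> = kron_vecs xs $ f i" using f(1)[OF i] by simp
      also have "\<dots> = (\<Prod>s<?d. xs ! s $ (L ! f i ! s))" by (rule kron[OF len xs f(1)[OF i]])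
      also have "\<dots> = (\<Prod>s<?d. xs ! \<sigma> s $ (L ! f i ! \<sigma> s))"
        by (rule prod.permute[OF \<sigma>, unfolded comp_def])
      also have "\<dots> = (\<Prod>s<?d. xs ! \<sigma> s $ (L' ! i ! s))"
        using f(2)[OF i] by (intro prod.cong) auto
      also have "\<dots> = kron_vecs ?ys $ i"
        using kron_vecs_index[of i ?ys] i unfolding ys by (simp add: n' L'_def)
      finally show "(W *\<^sub>v kron_vecs xs) $ i = kron_vecs ?ys $ i" .
    qed (simp add: W_def dimy)
  qed (simp add: W_def)
  moreover have "V = V'" if V: "is_swap_matrix ns \<sigma> V" and V': "is_swap_matrix ns \<sigma> V'" for V V'
  proof -
    have car: "V \<in> carrier_mat ?n ?n" "V' \<in> carrier_mat ?n ?n"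
      using V V' by (auto simp: is_swap_matrix_def)
    show ?thesis
    proof (rule eq_matI)
      fix i j assume "i < dim_row V'" "j < dim_col V'"
      then have i: "i < ?n" and j: "j < ?n" using car by auto
      define xs :: "real vec list" where "xs = map (\<lambda>s. unit_vec (ns ! s) (L ! j ! s)) [0..<?d]"
      have len: "length xs = ?d" and xs: "\<forall>s<?d. xs ! s \<in> carrier_vec (ns ! s)"
        by (auto simp: xs_def)
      have "kron_vecs xs = unit_vec ?n j"
      proof (rule eq_vecI)
        fix k assume "k < dim_vec (unit_vec ?n j :: real vec)"
        then have k: "k < ?n" by simp
        have "kron_vecs xs $ k = (\<Prod>s<?d. if L ! k ! s = L ! j ! s then 1 else 0)"
          using Lnth(2)[OF k] Lnth(2)[OF j]
          by (subst kron[OF len xs k]) (intro prod.cong, auto simp: xs_def unit_vec_def)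
        also have "\<dots> = (if k = j then 1 else 0)"
        proof (cases "k = j")
          case False
          then obtain s where "s < ?d" "L ! k ! s \<noteq> L ! j ! s" using Leq[OF k j] by blast
          with False show ?thesis by (auto intro!: prod_zero)
        qed simp
        finally show "kron_vecs xs $ k = unit_vec ?n j $ k" using j k by (simp add: unit_vec_def)
      qed (use dimk[OF len xs j] in simp)
      moreover have "V *\<^sub>v kron_vecs xs = V' *\<^sub>v kron_vecs xs"
        using V V' len xs by (simp add: is_swap_matrix_def)
      ultimately have "(V *\<^sub>v unit_vec ?n j) $ i = (V' *\<^sub>v unit_vec ?n j) $ i" by simp
      then show "V $$ (i, j) = V' $$ (i, j)"
        using car i j by simp
    qed (use car in auto)
  qed
  ultimately show ?thesis by blast
qed

end

theory Submission
  imports Defs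
begin

text \<open>
  The swap matrix \<open>W\<close> turns the row stacking of a Kronecker product into a Kronecker product of row
  stackings,
  \<open>W V\<^sub>r(A\<^sub>0 \<otimes> \<dots> \<otimes> A\<^sub>r\<^sub>-\<^sub>1) = V\<^sub>r(A\<^sub>0) \<otimes> \<dots> \<otimes> V\<^sub>r(A\<^sub>r\<^sub>-\<^sub>1)\<close>
  (\<open>swap_row_stacking_kron_mats\<close>).  Indeed \<open>V\<^sub>r\<close> reads the entries in the lexicographic order of the
  multi-indices \<open>(p\<^sub>0,\<dots>,p\<^sub>r\<^sub>-\<^sub>1,q\<^sub>0,\<dots>,q\<^sub>r\<^sub>-\<^sub>1)\<close>, and \<open>W\<close> reorders them to
  \<open>(p\<^sub>0,q\<^sub>0,\<dots>,p\<^sub>r\<^sub>-\<^sub>1,q\<^sub>r\<^sub>-\<^sub>1)\<close> (\<open>swap_matrix_mult_index\<close>).  Two neighbouring digits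
  \<open>(p\<^sub>s,q\<^sub>s)\<close> then form the single digit \<open>p\<^sub>s n\<^sub>r\<^sub>+\<^sub>s + q\<^sub>s\<close> (\<open>nth_lex_indices_merge_pairs\<close>), which is
  the position of the entry \<open>(p\<^sub>s,q\<^sub>s)\<close> of \<open>A\<^sub>s\<close> in \<open>V\<^sub>r(A\<^sub>s)\<close>.

  This identity shows that a matrix form decomposition yields a decomposition of the vector.
  Conversely, every vector \<open>x\<^sub>s\<close> of dimension \<open>n\<^sub>s n\<^sub>r\<^sub>+\<^sub>s\<close> is \<open>V\<^sub>r(A\<^sub>s)\<close> for some \<open>A\<^sub>s\<close>
  (\<open>row_stacking_reshape\<close>), so the identity gives \<open>W V\<^sub>r(A) = W V\<^sub>r(A\<^sub>0 \<otimes> \<dots> \<otimes> A\<^sub>r\<^sub>-\<^sub>1)\<close>, and \<open>W\<close> and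
  \<open>V\<^sub>r\<close> are both injective (\<open>swap_matrix_mult_inject\<close>, \<open>row_stacking_inject\<close>).
\<close>

section \<open>Digits of lexicographic positions\<close>

lemma nth_lex_indices:
  assumes "k < prod_list ns"
  shows "length (lex_indices ns ! k) = length ns"
    and "s < length ns \<Longrightarrow> lex_indices ns ! k ! s < ns ! s"
  using nth_mem[of k "lex_indices ns"] assms by (simp_all add: length_lex_indices set_lex_indices)

lemma lex_indices_nth_exists:
  assumes "length is = length ns" "\<And>s. s < length ns \<Longrightarrow> is ! s < ns ! s"
  shows "\<exists>k<prod_list ns. lex_indices ns ! k = is"
proof -
  have "is \<in> set (lex_indices ns)" using assms by (simp add: set_lex_indices)
  then show ?thesis unfolding in_set_conv_nth length_lex_indices .
qed

lemma lex_indices_nth_inject: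
  assumes "j < prod_list ns" "k < prod_list ns"
    and "\<And>s. s < length ns \<Longrightarrow> lex_indices ns ! j ! s = lex_indices ns ! k ! s"
  shows "j = k"
proof -
  have "lex_indices ns ! j = lex_indices ns ! k"
    using assms nth_lex_indices by (intro nth_equalityI) auto
  then show ?thesis
    using assms by (simp add: nth_eq_iff_index_eq distinct_lex_indices length_lex_indices)
qed

text \<open>
  Division with remainder by the number of positions of the last block separates the two blocks of
  digits.  For dimensions split into row and column dimensions, quotient and remainder are the row and
  the column from which the row stacking takes its entry at \<open>k\<close>.
\<close>

lemma nth_lex_indices_append:
  assumes "k < prod_list ms * prod_list ns"
  shows "lex_indices (ms @ ns) ! k =
           lex_indices ms ! (k div prod_list ns) @ lex_indices ns ! (k mod prod_list ns)"
  using assms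
proof (induction ms arbitrary: k)
  case Nil
  then show ?case by (simp add: lex_indices_def)
next
  case (Cons m ms)
  let ?M = "prod_list ms" and ?N = "prod_list ns"
  have pos: "?M * ?N > 0" using Cons.prems by (cases "?M * ?N") auto
  have "k div ?N < m * ?M"
    using Cons.prems by (simp add: less_mult_imp_div_less)
  moreover have "(k mod (?M * ?N)) div ?N = (k div ?N) mod ?M"
    using pos mod_mult2_eq[of k ?N ?M] by (simp add: mult.commute)
  moreover have "k mod (?M * ?N) mod ?N = k mod ?N"
    by (simp add: mod_mod_cancel)
  moreover have "k div (?M * ?N) = k div ?N div ?M"
    using div_mult2_eq[of k ?N ?M] by (simp add: mult.commute)
  ultimately show ?case
    using Cons.prems pos Cons.IH[of "k mod (?M * ?N)"]
    by (simp add: nth_lex_indices_Cons mult.assoc)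
qed

text \<open>
  Merging each pair of consecutive digits, with bases \<open>m\<close> and \<open>n\<close>, into one digit with base \<open>m * n\<close>
  keeps the lexicographic order, so the position \<open>k\<close> is the same on both sides.
\<close>

lemma nth_lex_indices_merge_pairs:
  assumes "k < prod_list (map (\<lambda>(m, n). m * n) ps)" "s < length ps"
  shows "lex_indices (map (\<lambda>(m, n). m * n) ps) ! k ! s =
           lex_indices (concat (map (\<lambda>(m, n). [m, n]) ps)) ! k ! (2 * s) * snd (ps ! s) +
           lex_indices (concat (map (\<lambda>(m, n). [m, n]) ps)) ! k ! (2 * s + 1)"
  using assms
proof (induction ps arbitrary: k s)
  case (Cons p ps)
  obtain m n where p: "p = (m, n)" by fastforce
  let ?C = "concat (map (\<lambda>(m, n). [m, n]) ps)"
  let ?R = "prod_list (map (\<lambda>(m, n). m * n) ps)"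
  have R: "prod_list ?C = ?R" by (induction ps) auto
  have k: "k < m * n * ?R" using Cons.prems p by simp
  then have pos: "n * ?R > 0" by (cases "n * ?R") (auto simp: mult.assoc)
  have "?R > 0" using pos by simp
  have "lex_indices (m # n # ?C) ! k = (k div (n * ?R)) # lex_indices (n # ?C) ! (k mod (n * ?R))"
    using k R by (simp add: nth_lex_indices_Cons mult.assoc)
  also have "lex_indices (n # ?C) ! (k mod (n * ?R)) =
      (k mod (n * ?R) div ?R) # lex_indices ?C ! (k mod (n * ?R) mod ?R)"
    using pos R by (simp add: nth_lex_indices_Cons)
  also have "k mod (n * ?R) mod ?R = k mod ?R"
    by (simp add: mod_mod_cancel)
  finally have split: "lex_indices (m # n # ?C) ! k =
      (k div (n * ?R)) # (k mod (n * ?R) div ?R) # lex_indices ?C ! (k mod ?R)" .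
  have merge: "lex_indices ((m * n) # map (\<lambda>(m, n). m * n) ps) ! k =
      (k div ?R) # lex_indices (map (\<lambda>(m, n). m * n) ps) ! (k mod ?R)"
    using k by (simp add: nth_lex_indices_Cons)
  show ?case
  proof (cases s)
    case 0
    have "k div ?R = (k div (n * ?R) * (n * ?R) + k mod (n * ?R)) div ?R"
      by (simp only: div_mult_mod_eq)
    also have "\<dots> = (k mod (n * ?R) + k div (n * ?R) * n * ?R) div ?R"
      by (simp only: mult.assoc add.commute)
    also have "\<dots> = k div (n * ?R) * n + k mod (n * ?R) div ?R"
      using \<open>?R > 0\<close> by (intro div_mult_self1) simp
    finally show ?thesis using 0 split merge by (simp add: p)
  next
    case (Suc t)
    then show ?thesis
      using Cons.IH[of "k mod ?R" t] Cons.prems \<open>?R > 0\<close> split merge by (simp add: p)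
  qed
qed simp

section \<open>The action of the swap matrix\<close>

lemma prod_list_permuted:
  fixes ns :: "'a :: comm_monoid_mult list"
  assumes "\<sigma> permutes {..<length ns}"
  shows "prod_list (map (\<lambda>s. ns ! \<sigma> s) [0..<length ns]) = prod_list ns"
  using prod.permute[OF assms, of "(!) ns"]
  by (simp add: prod.list_conv_set_nth atLeast0LessThan comp_def)

lemma kron_vecs_unit_vecs:
  assumes "j < prod_list ns"
  shows "kron_vecs (map (\<lambda>s. unit_vec (ns ! s) (lex_indices ns ! j ! s)) [0..<length ns]) =
           unit_vec (prod_list ns) j" (is "kron_vecs ?xs = _")
proof (rule eq_vecI)
  have dims: "map dim_vec ?xs = ns" by (intro nth_equalityI) auto
  show "dim_vec (kron_vecs ?xs) = dim_vec (unit_vec (prod_list ns) j :: real vec)"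
    by (simp only: dim_kron_vecs dims) simp
  fix k assume "k < dim_vec (unit_vec (prod_list ns) j :: real vec)"
  then have k: "k < prod_list ns" by simp
  have "kron_vecs ?xs $ k =
      (\<Prod>s<length ns. if lex_indices ns ! k ! s = lex_indices ns ! j ! s then 1 else 0)"
    using kron_vecs_index[of k ?xs] k nth_lex_indices[OF k] nth_lex_indices[OF assms]
    unfolding dims by (auto simp: unit_vec_def intro!: prod.cong)
  also have "\<dots> = (if k = j then 1 else 0)"
    using lex_indices_nth_inject[OF k assms] by (auto intro!: prod_zero)
  finally show "kron_vecs ?xs $ k = unit_vec (prod_list ns) j $ k"
    using assms k by (simp add: unit_vec_def)
qed

text \<open>
  The defining property of the swap matrix speaks of Kronecker products only, but the unit vectors
  are among them, so it determines all columns.  The result: \<open>W\<close> permutes the entries of an arbitrary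
  vector by permuting the digits of their positions.
\<close>

lemma swap_matrix_mult_index:
  assumes \<sigma>: "\<sigma> permutes {..<length ns}"
    and v: "v \<in> carrier_vec (prod_list ns)"
    and i: "i < prod_list ns" and j: "j < prod_list ns"
    and digits: "\<And>s. s < length ns \<Longrightarrow>
      lex_indices (map (\<lambda>s. ns ! \<sigma> s) [0..<length ns]) ! i ! s = lex_indices ns ! j ! \<sigma> s"
  shows "(swap_matrix ns \<sigma> *\<^sub>v v) $ i = v $ j"
proof -
  let ?W = "swap_matrix ns \<sigma>" and ?n = "prod_list ns" and ?d = "length ns"
  have W: "is_swap_matrix ns \<sigma> ?W"
    unfolding swap_matrix_def by (rule theI'[OF ex1_swap_matrix[OF \<sigma>]])
  then have car: "?W \<in> carrier_mat ?n ?n" by (simp add: is_swap_matrix_def)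
  have \<sigma>_less: "\<sigma> s < ?d" if "s < ?d" for s
    using permutes_in_image[OF \<sigma>, of s] that by simp
  have entry: "?W $$ (i, k) = (if k = j then 1 else 0)" if k: "k < ?n" for k
  proof -
    let ?xs = "map (\<lambda>s. unit_vec (ns ! s) (lex_indices ns ! k ! s)) [0..<?d] :: real vec list"
    let ?ys = "map (\<lambda>s. ?xs ! \<sigma> s) [0..<?d]"
    have dims: "map dim_vec ?ys = map (\<lambda>s. ns ! \<sigma> s) [0..<?d]"
      using \<sigma>_less by auto
    have "?W $$ (i, k) = (?W *\<^sub>v unit_vec ?n k) $ i"
      using car i k by simp
    also have "\<dots> = kron_vecs ?ys $ i"
      using W by (simp add: is_swap_matrix_def flip: kron_vecs_unit_vecs[OF k])
    also have "\<dots> = (\<Prod>s<?d. unit_vec (ns ! \<sigma> s) (lex_indices ns ! k ! \<sigma> s) $ (lex_indices ns ! j ! \<sigma> s))"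
      using kron_vecs_index[of i ?ys] i \<sigma>_less digits
      unfolding dims by (auto simp: prod_list_permuted[OF \<sigma>] intro!: prod.cong)
    also have "\<dots> = (\<Prod>s<?d. unit_vec (ns ! s) (lex_indices ns ! k ! s) $ (lex_indices ns ! j ! s))"
      by (rule prod.permute[OF \<sigma>, unfolded comp_def, symmetric])
    also have "\<dots> = unit_vec ?n k $ j"
      using kron_vecs_index[of j ?xs] j map_nth[of ns]
      by (simp add: kron_vecs_unit_vecs[OF k] comp_def)
    finally show ?thesis using j k by (auto simp: unit_vec_def)
  qed
  have "(?W *\<^sub>v v) $ i = (\<Sum>k<?n. ?W $$ (i, k) * v $ k)"
    using car v i by (auto simp: scalar_prod_def atLeast0LessThan intro!: sum.cong)
  also have "\<dots> = (\<Sum>k<?n. if k = j then v $ k else 0)"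
    using entry by (intro sum.cong) auto
  finally show ?thesis using j by simp
qed

lemma permuted_position_exists:
  assumes \<sigma>: "\<sigma> permutes {..<length ns}" and j: "j < prod_list ns"
  shows "\<exists>i<prod_list ns. \<forall>s<length ns.
    lex_indices (map (\<lambda>s. ns ! \<sigma> s) [0..<length ns]) ! i ! s = lex_indices ns ! j ! \<sigma> s"
proof -
  have "\<sigma> s < length ns" if "s < length ns" for s
    using permutes_in_image[OF \<sigma>, of s] that by simp
  then have "\<exists>i<prod_list (map (\<lambda>s. ns ! \<sigma> s) [0..<length ns]).
      lex_indices (map (\<lambda>s. ns ! \<sigma> s) [0..<length ns]) ! i =
        map (\<lambda>s. lex_indices ns ! j ! \<sigma> s) [0..<length ns]"
    using nth_lex_indices(2)[OF j] by (intro lex_indices_nth_exists) simp_all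
  then obtain i where "i < prod_list ns"
      "lex_indices (map (\<lambda>s. ns ! \<sigma> s) [0..<length ns]) ! i =
        map (\<lambda>s. lex_indices ns ! j ! \<sigma> s) [0..<length ns]"
    unfolding prod_list_permuted[OF \<sigma>] by blast
  then show ?thesis by (intro exI[of _ i]) simp
qed

lemma original_position_exists:
  assumes \<sigma>: "\<sigma> permutes {..<length ns}" and i: "i < prod_list ns"
  shows "\<exists>j<prod_list ns. \<forall>s<length ns.
    lex_indices (map (\<lambda>s. ns ! \<sigma> s) [0..<length ns]) ! i ! s = lex_indices ns ! j ! \<sigma> s"
proof -
  let ?L' = "lex_indices (map (\<lambda>s. ns ! \<sigma> s) [0..<length ns])"
  have inv_less: "inv_into UNIV \<sigma> s < length ns" if "s < length ns" for s
    using permutes_in_image[OF permutes_inv[OF \<sigma>], of s] that by simp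
  have \<sigma>_less: "\<sigma> s < length ns" if "s < length ns" for s
    using permutes_in_image[OF \<sigma>, of s] that by simp
  have "?L' ! i ! s < ns ! \<sigma> s" if "s < length ns" for s
    using nth_lex_indices(2)[of i "map (\<lambda>s. ns ! \<sigma> s) [0..<length ns]" s] i that
    by (simp add: prod_list_permuted[OF \<sigma>])
  from this[OF inv_less] have "?L' ! i ! inv_into UNIV \<sigma> s < ns ! s" if "s < length ns" for s
    using that by (simp add: permutes_inverses(1)[OF \<sigma>])
  then have "\<exists>j<prod_list ns. lex_indices ns ! j = map (\<lambda>s. ?L' ! i ! inv_into UNIV \<sigma> s) [0..<length ns]"
    by (intro lex_indices_nth_exists) simp_all
  then obtain j where "j < prod_list ns"
      "lex_indices ns ! j = map (\<lambda>s. ?L' ! i ! inv_into UNIV \<sigma> s) [0..<length ns]"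
    by blast
  moreover from this have "\<forall>s<length ns. ?L' ! i ! s = lex_indices ns ! j ! \<sigma> s"
    using \<sigma>_less by (simp add: permutes_inverses(2)[OF \<sigma>])
  ultimately show ?thesis by blast
qed

text \<open>Multiplication by \<open>W\<close> loses no information: each entry of \<open>v\<close> reappears in \<open>W v\<close>.\<close>

lemma swap_matrix_mult_inject:
  assumes \<sigma>: "\<sigma> permutes {..<length ns}"
    and v: "v \<in> carrier_vec (prod_list ns)" and w: "w \<in> carrier_vec (prod_list ns)"
    and eq: "swap_matrix ns \<sigma> *\<^sub>v v = swap_matrix ns \<sigma> *\<^sub>v w"
  shows "v = w"
proof (rule eq_vecI)
  fix j assume "j < dim_vec w"
  then have j: "j < prod_list ns" using w by simp
  then obtain i where "i < prod_list ns" "\<forall>s<length ns.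
      lex_indices (map (\<lambda>s. ns ! \<sigma> s) [0..<length ns]) ! i ! s = lex_indices ns ! j ! \<sigma> s"
    using permuted_position_exists[OF \<sigma>] by blast
  then show "v $ j = w $ j"
    using swap_matrix_mult_index[OF \<sigma> v _ j] swap_matrix_mult_index[OF \<sigma> w _ j] eq by simp
qed (use v w in simp)

section \<open>Row stacking and Kronecker products\<close>

lemma dim_kron_mats:
  "dim_row (kron_mats As) = prod_list (map dim_row As)"
  "dim_col (kron_mats As) = prod_list (map dim_col As)"
  by (induction As) (auto simp: kron_mats_def kron_mat_def)

lemma kron_mats_index:
  assumes "p < prod_list (map dim_row As)" "q < prod_list (map dim_col As)"
  shows "kron_mats As $$ (p, q) =
    (\<Prod>s<length As. As ! s $$ (lex_indices (map dim_row As) ! p ! s,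
                             lex_indices (map dim_col As) ! q ! s))"
  using assms
proof (induction As arbitrary: p q)
  case Nil
  then show ?case by (simp add: kron_mats_def)
next
  case (Cons A As)
  let ?m = "prod_list (map dim_row As)" and ?n = "prod_list (map dim_col As)"
  have "?m > 0" "?n > 0" using Cons.prems by (cases ?m; cases ?n; auto)+
  then have "p mod ?m < ?m" "q mod ?n < ?n" by simp_all
  moreover have "kron_mats (A # As) $$ (p, q) =
      A $$ (p div ?m, q div ?n) * kron_mats As $$ (p mod ?m, q mod ?n)"
    using Cons.prems dim_kron_mats[of As] by (simp add: kron_mats_def kron_mat_def)
  ultimately show ?case
    using Cons by (simp add: nth_lex_indices_Cons prod.lessThan_Suc_shift del: prod.lessThan_Suc)
qed

lemma row_stacking_carrier: "row_stacking A \<in> carrier_vec (dim_row A * dim_col A)"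
  by (simp add: row_stacking_def carrier_vecI)

lemma mult_add_less_mult:
  fixes i j m n :: nat
  assumes "i < m" "j < n"
  shows "i * n + j < m * n"
proof -
  have "i * n + j < Suc i * n" using assms by simp
  also have "\<dots> \<le> m * n" using assms by (intro mult_le_mono1) simp
  finally show ?thesis .
qed

lemma row_stacking_index:
  assumes "i < dim_row A" "j < dim_col A"
  shows "row_stacking A $ (i * dim_col A + j) = A $$ (i, j)"
  using assms mult_add_less_mult[OF assms] by (simp add: row_stacking_def)

lemma row_stacking_inject:
  assumes "A \<in> carrier_mat m n" "B \<in> carrier_mat m n" "row_stacking A = row_stacking B"
  shows "A = B"
proof (rule eq_matI)
  fix i j assume "i < dim_row B" "j < dim_col B"
  then show "A $$ (i, j) = B $$ (i, j)"
    using assms row_stacking_index[of i A j] row_stacking_index[of i B j] by auto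
qed (use assms in auto)

lemma row_stacking_reshape:
  assumes "x \<in> carrier_vec (m * n)"
  shows "row_stacking (mat m n (\<lambda>(i, j). x $ (i * n + j))) = x"
proof (rule eq_vecI)
  fix k assume "k < dim_vec x"
  then have "k < m * n" using assms by simp
  moreover from this have "n > 0" by (cases n) auto
  ultimately show "row_stacking (mat m n (\<lambda>(i, j). x $ (i * n + j))) $ k = x $ k"
    by (simp add: row_stacking_def less_mult_imp_div_less)
qed (use assms in \<open>simp add: row_stacking_def\<close>)

lemma map_interleaving:
  assumes "\<And>s. s < r \<Longrightarrow> \<sigma> (2 * s) = s \<and> \<sigma> (2 * s + 1) = r + s"
  shows "map (\<lambda>s. f (\<sigma> s)) [0..<2 * r] = concat (map (\<lambda>s. [f s, f (r + s)]) [0..<r])"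
proof -
  have "map (\<lambda>s. f (\<sigma> s)) [0..<2 * t] = concat (map (\<lambda>s. [f s, f (r + s)]) [0..<t])" if "t \<le> r" for t
    using that
  proof (induction t)
    case (Suc t)
    then show ?case using assms[of t] by simp
  qed simp
  then show ?thesis by simp
qed

text \<open>
  Both sides are compared entrywise.  If the position \<open>i\<close> has digits
  \<open>(p\<^sub>0,q\<^sub>0,\<dots>,p\<^sub>r\<^sub>-\<^sub>1,q\<^sub>r\<^sub>-\<^sub>1)\<close> in the interleaved dimensions, then either entry at \<open>i\<close> is the product
  of the entries \<open>(p\<^sub>s,q\<^sub>s)\<close> of the factors.
\<close>

lemma swap_row_stacking_kron_mats:
  assumes ns: "length ns = 2 * r" and \<sigma>: "\<sigma> permutes {..<2 * r}"
    and interleave: "\<And>s. s < r \<Longrightarrow> \<sigma> (2 * s) = s \<and> \<sigma> (2 * s + 1) = r + s"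
    and len: "length As = r"
    and As: "\<And>s. s < r \<Longrightarrow> As ! s \<in> carrier_mat (ns ! s) (ns ! (r + s))"
  shows "swap_matrix ns \<sigma> *\<^sub>v row_stacking (kron_mats As) = kron_vecs (map row_stacking As)"
proof -
  let ?N = "prod_list ns" and ?R = "take r ns" and ?C = "drop r ns"
  let ?ps = "map (\<lambda>s. (ns ! s, ns ! (r + s))) [0..<r]"
  define L where "L = lex_indices ns"
  define L' where "L' = lex_indices (map (\<lambda>s. ns ! \<sigma> s) [0..<2 * r])"
  have \<sigma>': "\<sigma> permutes {..<length ns}" using \<sigma> ns by simp
  have dim_As: "dim_row (As ! s) = ns ! s" "dim_col (As ! s) = ns ! (r + s)" if "s < r" for s
    using As[OF that] by auto
  have dims: "map dim_row As = ?R" "map dim_col As = ?C"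
    using dim_As len ns by (auto intro!: nth_equalityI)
  have N: "?N = prod_list ?R * prod_list ?C"
    by (metis append_take_drop_id prod_list.append)
  have vec_dims: "map dim_vec (map row_stacking As) = map (\<lambda>(m, n). m * n) ?ps"
    using dim_As len by (auto simp: row_stacking_def intro!: nth_equalityI)
  have pairs: "map (\<lambda>s. ns ! \<sigma> s) [0..<2 * r] = concat (map (\<lambda>(m, n). [m, n]) ?ps)"
    by (simp add: map_interleaving[OF interleave] comp_def)
  have prod_pairs: "prod_list (concat (map (\<lambda>(m, n). [m, n]) ps)) = prod_list (map (\<lambda>(m, n). m * n) ps)"
    for ps :: "(nat \<times> nat) list"
    by (induction ps) auto
  have N': "prod_list (map (\<lambda>(m, n). m * n) ?ps) = ?N"
    by (rule prod_list_permuted[OF \<sigma>', unfolded ns pairs prod_pairs])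
  have car: "row_stacking (kron_mats As) \<in> carrier_vec ?N"
    using row_stacking_carrier[of "kron_mats As"] by (simp only: dim_kron_mats dims N)
  show ?thesis
  proof (rule eq_vecI)
    have "swap_matrix ns \<sigma> \<in> carrier_mat ?N ?N"
      using theI'[OF ex1_swap_matrix[OF \<sigma>']] by (simp add: swap_matrix_def is_swap_matrix_def)
    then show "dim_vec (swap_matrix ns \<sigma> *\<^sub>v row_stacking (kron_mats As)) =
        dim_vec (kron_vecs (map row_stacking As))"
      by (simp only: dim_kron_vecs vec_dims N') simp
    fix i assume "i < dim_vec (kron_vecs (map row_stacking As))"
    then have i: "i < ?N" by (simp only: dim_kron_vecs vec_dims N')
    (* j is the position with the same digits in the original order. *)
    obtain j where j: "j < ?N" and digits: "\<And>s. s < 2 * r \<Longrightarrow> L' ! i ! s = L ! j ! \<sigma> s"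
      using original_position_exists[OF \<sigma>' i] unfolding L_def L'_def ns by blast
    define p where "p = j div prod_list ?C"
    define q where "q = j mod prod_list ?C"
    have "prod_list ?C > 0" using j N by (cases "prod_list ?C") auto
    then have p: "p < prod_list ?R" and q: "q < prod_list ?C"
      using j N by (simp_all add: p_def q_def less_mult_imp_div_less)
    have "L ! j = lex_indices ?R ! p @ lex_indices ?C ! q"
      using nth_lex_indices_append[of j ?R ?C] j N by (simp add: L_def p_def q_def)
    then have row: "L ! j ! s = lex_indices ?R ! p ! s"
      and col: "L ! j ! (r + s) = lex_indices ?C ! q ! s" if "s < r" for s
      using nth_lex_indices(1)[OF p] ns that by (simp_all add: nth_append)
    have "(swap_matrix ns \<sigma> *\<^sub>v row_stacking (kron_mats As)) $ i = row_stacking (kron_mats As) $ j"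
      using digits ns by (intro swap_matrix_mult_index[OF \<sigma>' car i j]) (simp add: L_def L'_def)
    also have "\<dots> = kron_mats As $$ (p, q)"
      using j N by (simp add: row_stacking_def dim_kron_mats dims p_def q_def)
    also have "\<dots> = (\<Prod>s<r. As ! s $$ (L ! j ! s, L ! j ! (r + s)))"
      using kron_mats_index[of p As q] p q row col unfolding dims len by simp
    also have "\<dots> = (\<Prod>s<r. row_stacking (As ! s) $ (lex_indices (map (\<lambda>(m, n). m * n) ?ps) ! i ! s))"
    proof (intro prod.cong refl)
      fix s assume "s \<in> {..<r}"
      then have s: "s < r" by simp
      have "L ! j ! s < ns ! s" "L ! j ! (r + s) < ns ! (r + s)"
        using nth_lex_indices(2)[OF j] s ns by (simp_all add: L_def)
      moreover have "lex_indices (map (\<lambda>(m, n). m * n) ?ps) ! i ! s =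
          L ! j ! s * ns ! (r + s) + L ! j ! (r + s)"
        using nth_lex_indices_merge_pairs[of i ?ps s] i N' s
          digits[of "2 * s"] digits[of "2 * s + 1"] interleave[OF s]
        unfolding pairs[symmetric] by (simp add: L'_def)
      ultimately show "As ! s $$ (L ! j ! s, L ! j ! (r + s)) =
          row_stacking (As ! s) $ (lex_indices (map (\<lambda>(m, n). m * n) ?ps) ! i ! s)"
        using row_stacking_index[of "L ! j ! s" "As ! s" "L ! j ! (r + s)"] dim_As[OF s] by simp
    qed
    also have "\<dots> = kron_vecs (map row_stacking As) $ i"
      using kron_vecs_index[of i "map row_stacking As"] i len unfolding vec_dims N' by simp
    finally show "(swap_matrix ns \<sigma> *\<^sub>v row_stacking (kron_mats As)) $ i =
        kron_vecs (map row_stacking As) $ i" .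
  qed
qed

section \<open>Matrix form decomposability\<close>

theorem corollary4p3:
  fixes r :: nat and ns :: "nat list" and a :: hypermatrix and \<sigma> :: "nat \<Rightarrow> nat"
  assumes "r \<ge> 1"
    and "length ns = 2 * r"
    and "\<forall>n\<in>set ns. n > 0"
    and "\<sigma> permutes {..<2 * r}"
    and "\<forall>s<r. \<sigma> (2 * s) = s \<and> \<sigma> (2 * s + 1) = r + s"
  shows "matrix_form_decomposable r ns a \<longleftrightarrow>
         decomposable_vec (map (\<lambda>s. ns ! s * ns ! (r + s)) [0..<r])
           (swap_matrix ns \<sigma> *\<^sub>v row_stacking (matrix_form r ns a))"
proof
  let ?W = "swap_matrix ns \<sigma>" and ?A = "matrix_form r ns a"
  have swap: "?W *\<^sub>v row_stacking (kron_mats As) = kron_vecs (map row_stacking As)"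
    if "length As = r" "\<And>s. s < r \<Longrightarrow> As ! s \<in> carrier_mat (ns ! s) (ns ! (r + s))" for As
    using swap_row_stacking_kron_mats[of ns r \<sigma> As] assms that by blast
  {
    assume "matrix_form_decomposable r ns a"
    then obtain As where len: "length As = r"
        and As: "\<And>s. s < r \<Longrightarrow> As ! s \<in> carrier_mat (ns ! s) (ns ! (r + s))"
        and "?A = kron_mats As"
      unfolding matrix_form_decomposable_def by blast
    then have "?W *\<^sub>v row_stacking ?A = kron_vecs (map row_stacking As)"
      using swap by simp
    moreover have "row_stacking (As ! s) \<in> carrier_vec (ns ! s * ns ! (r + s))" if "s < r" for s
      using row_stacking_carrier[of "As ! s"] As[OF that] by auto
    ultimately show "decomposable_vec (map (\<lambda>s. ns ! s * ns ! (r + s)) [0..<r]) (?W *\<^sub>v row_stacking ?A)"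
      using len unfolding decomposable_vec_def by (intro exI[of _ "map row_stacking As"]) simp
  }
  {
    assume "decomposable_vec (map (\<lambda>s. ns ! s * ns ! (r + s)) [0..<r]) (?W *\<^sub>v row_stacking ?A)"
    then obtain xs where len: "length xs = r"
        and xs: "\<And>s. s < r \<Longrightarrow> xs ! s \<in> carrier_vec (ns ! s * ns ! (r + s))"
        and eq: "?W *\<^sub>v row_stacking ?A = kron_vecs xs"
      unfolding decomposable_vec_def by auto
    (* The row by row reshaping of each factor: the only choice with row stacking xs ! s. *)
    define As where "As =
      map (\<lambda>s. mat (ns ! s) (ns ! (r + s)) (\<lambda>(i, j). xs ! s $ (i * ns ! (r + s) + j))) [0..<r]"
    have lenA: "length As = r"
      and As: "\<And>s. s < r \<Longrightarrow> As ! s \<in> carrier_mat (ns ! s) (ns ! (r + s))"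
      by (simp_all add: As_def)
    have "map row_stacking As = xs"
      using len xs by (intro nth_equalityI) (simp_all add: As_def row_stacking_reshape)
    then have W_eq: "?W *\<^sub>v row_stacking ?A = ?W *\<^sub>v row_stacking (kron_mats As)"
      using eq swap[OF lenA As] by simp
    have "map dim_row As = take r ns" "map dim_col As = drop r ns"
      using assms(2) by (auto simp: As_def intro!: nth_equalityI)
    then have kron_car: "kron_mats As \<in> carrier_mat (prod_list (take r ns)) (prod_list (drop r ns))"
      by (intro carrier_matI) (simp_all only: dim_kron_mats)
    have A_car: "?A \<in> carrier_mat (prod_list (take r ns)) (prod_list (drop r ns))"
      by (simp add: matrix_form_def)
    have "prod_list ns = prod_list (take r ns) * prod_list (drop r ns)"
      by (metis append_take_drop_id prod_list.append)
    then have "row_stacking ?A \<in> carrier_vec (prod_list ns)"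
        "row_stacking (kron_mats As) \<in> carrier_vec (prod_list ns)"
      using row_stacking_carrier[of ?A] row_stacking_carrier[of "kron_mats As"]
      by (simp_all only: carrier_matD[OF A_car] carrier_matD[OF kron_car])
    then have "row_stacking ?A = row_stacking (kron_mats As)"
      using swap_matrix_mult_inject[of \<sigma> ns] W_eq assms(2,4) by simp
    then have "?A = kron_mats As"
      by (rule row_stacking_inject[OF A_car kron_car])
    then show "matrix_form_decomposable r ns a"
      using lenA As unfolding matrix_form_decomposable_def by blast
  }
qed

end
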